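(* Let $d\ge 1$ and let $\Lambda\subset\mathbb{N}_0^d$ be a finite set. Then the minimal numbers of rank-1 lattice points $n_A^*(\Lambda)$, $n_B^*(\Lambda)$, $n_C^*(\Lambda)$ for Plans A, B, C satisfy $$n_A^*(\Lambda)\ \ge\ \#\mathcal{M}(\Lambda)+1_{\mathbf{0}\notin\Lambda},\qquad n_B^*(\Lambda)\ \ge\ 2\,\#\Lambda+\epsilon_{\Lambda,\mathbf{0}},\qquad n_C^*(\Lambda)\ \ge\ 2\,\#\Lambda-2,$$ where $1_{\mathbf{0}\notin\Lambda}$ equals $1$ if $\mathbf{0}\notin\Lambda$ and $0$ otherwise, and $\epsilon_{\Lambda,\mathbf{0}}=1$ if $\mathbf{0}\notin\Lambda$ and $\epsilon_{\Lambda,\mathbf{0}}=-1$ otherwise.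
   Context: $\mathbb{N}=\{1,2,\dots\}$, $\mathbb{N}_0=\mathbb{N}\cup\{0\}$, and $\#$ denotes cardinality. For $n\in\mathbb{N}$, $a\equiv_n b$ means $a\equiv b \pmod n$. For $\mathbf{k}\in\mathbb{Z}^d$, $\mathcal{S}_{\mathbf{k}}$ is the set of the $2^{|\mathbf{k}|_0}$ component-wise sign changes acting on the nonzero coordinates of $\mathbf{k}$ (including the identity), where $|\mathbf{k}|_0$ is the number of nonzero coordinates. The mirrored set of $\Lambda\subset\mathbb{N}_0^d$ is $\mathcal{M}(\Lambda)=\{\sigma(\mathbf{k}):\mathbf{k}\in\Lambda,\ \sigma\in\mathcal{S}_{\mathbf{k}}\}\subset\mathbb{Z}^d$. A pair $(n,\mathbf{z})\in\mathbb{N}\times\mathbb{Z}^d$ is, for $\Lambda$: - admissible for Plan A if $\mathbf{h}\cdot\mathbf{z}\not\equiv_n\mathbf{h}'\cdot\mathbf{z}$ for all $\mathbf{h}\ne\mathbf{h}'\in\mathcal{M}(\Lambda)$; - admissible for Plan B if $\sigma(\mathbf{h})\cdot\mathbf{z}\not\equiv_n\mathbf{h}'\cdot\mathbf{z}$ for all $\mathbf{h},\mathbf{h}'\in\Lambda$ and $\sigma\in\mathcal{S}_{\mathbf{h}}$ with $\sigma(\mathbf{h})\ne\mathbf{h}'$; - admissible for Plan C if $\sigma(\mathbf{h})\cdot\mathbf{z}\not\equiv_n\mathbf{h}'\cdot\mathbf{z}$ for all $\mathbf{h},\mathbf{h}'\in\Lambda$ and $\sigma\in\mathcal{S}_{\mathbf{h}}$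 with $\mathbf{h}\ne\mathbf{h}'$. For $\square\in\{A,B,C\}$, $n_\square^*(\Lambda)$ is the smallest $n\in\mathbb{N}$ such that $(n,\mathbf{z})$ is admissible for Plan $\square$ for some $\mathbf{z}\in\mathbb{Z}^d$. *)

theory Defs
  imports "HOL-Analysis.Finite_Cartesian_Product" "HOL-Number_Theory.Cong"
begin

definition nonneg_vectors :: "(int ^ 'd) set" where
  "nonneg_vectors = {k. \<forall>i. 0 \<le> k $ i}"

definition int_dot :: "int ^ 'd \<Rightarrow> int ^ 'd \<Rightarrow> int" where
  "int_dot h z = (\<Sum>i\<in>UNIV. h $ i * z $ i)"

text \<open>Sign patterns are forced to be trivial on the zero coordinates of k, so that
  distinct patterns give distinct maps and there are exactly 2 to the number of
  nonzero coordinates of k of them.\<close>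

definition sign_changes :: "int ^ 'd \<Rightarrow> (int ^ 'd \<Rightarrow> int ^ 'd) set" where
  "sign_changes k =
     {\<sigma>. \<exists>s :: 'd \<Rightarrow> int. (\<forall>i. s i = 1 \<or> s i = -1) \<and> (\<forall>i. k $ i = 0 \<longrightarrow> s i = 1) \<and>
          \<sigma> = (\<lambda>h. \<chi> i. s i * h $ i)}"

definition mirrored :: "(int ^ 'd) set \<Rightarrow> (int ^ 'd) set" where
  "mirrored \<Lambda> = {\<sigma> k | \<sigma> k. k \<in> \<Lambda> \<and> \<sigma> \<in> sign_changes k}"

definition admissible_A :: "(int ^ 'd) set \<Rightarrow> nat \<Rightarrow> int ^ 'd \<Rightarrow> bool" where
  "admissible_A \<Lambda> n z \<longleftrightarrow>
     (\<forall>h\<in>mirrored \<Lambda>. \<forall>h'\<in>mirrored \<Lambda>.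
        h \<noteq> h' \<longrightarrow> \<not> [int_dot h z = int_dot h' z] (mod int n))"

definition admissible_B :: "(int ^ 'd) set \<Rightarrow> nat \<Rightarrow> int ^ 'd \<Rightarrow> bool" where
  "admissible_B \<Lambda> n z \<longleftrightarrow>
     (\<forall>h\<in>\<Lambda>. \<forall>h'\<in>\<Lambda>. \<forall>\<sigma>\<in>sign_changes h.
        \<sigma> h \<noteq> h' \<longrightarrow> \<not> [int_dot (\<sigma> h) z = int_dot h' z] (mod int n))"

definition admissible_C :: "(int ^ 'd) set \<Rightarrow> nat \<Rightarrow> int ^ 'd \<Rightarrow> bool" where
  "admissible_C \<Lambda> n z \<longleftrightarrow>
     (\<forall>h\<in>\<Lambda>. \<forall>h'\<in>\<Lambda>. \<forall>\<sigma>\<in>sign_changes h.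
        h \<noteq> h' \<longrightarrow> \<not> [int_dot (\<sigma> h) z = int_dot h' z] (mod int n))"

definition nstar_A :: "(int ^ 'd) set \<Rightarrow> nat" where
  "nstar_A \<Lambda> = (LEAST n. n \<ge> 1 \<and> (\<exists>z. admissible_A \<Lambda> n z))"

definition nstar_B :: "(int ^ 'd) set \<Rightarrow> nat" where
  "nstar_B \<Lambda> = (LEAST n. n \<ge> 1 \<and> (\<exists>z. admissible_B \<Lambda> n z))"

definition nstar_C :: "(int ^ 'd) set \<Rightarrow> nat" where
  "nstar_C \<Lambda> = (LEAST n. n \<ge> 1 \<and> (\<exists>z. admissible_C \<Lambda> n z))"

end

theory Submission imports Defs
begin

text \<open>Distinct residues modulo \<open>n\<close> are counted. For nonzero nonnegative \<open>h\<close>, the vector \<open>- h\<close> is a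
  mirror image of \<open>h\<close> outside \<open>\<Lambda>\<close>. Under Plans A and B no nonzero \<open>h\<close> can satisfy
  \<open>h \<cdot> z \<equiv> - h \<cdot> z\<close>, so the residue 0 is free for the zero vector, and Plan B separates all of
  \<open>{0} \<union> \<Lambda> \<union> - \<Lambda>\<close>. Under Plan C the exceptional \<open>h\<close> have residue 0 or \<open>n / 2\<close>, so there are at
  most two of them, and \<open>\<Lambda>\<close> is separated together with the negatives of all the other
  \<open>h\<close>. The minima exist because some \<open>z\<close>
  is orthogonal to none of the finitely many nonzero differences of points of \<open>\<M>(\<Lambda>)\<close>.\<close>

section \<open>Lattices that separate a finite set of integer vectors\<close>

lemma int_dot_zero [simp]: "int_dot 0 z = 0"
  by (simp add: int_dot_def)

lemma int_dot_minus [simp]: "int_dot (- h) z = - int_dot h z"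
  by (simp add: int_dot_def sum_negf)

lemma int_dot_diff: "int_dot (h - k) z = int_dot h z - int_dot k z"
  by (simp add: int_dot_def left_diff_distrib sum_subtractf)

text \<open>The second argument is \<open>t * z + e_i\<close>, with \<open>e_i\<close> the
  \<open>i\<close>-th unit vector: the perturbation that repairs an orthogonality in the next
  lemma.\<close>

lemma int_dot_shift:
  "int_dot h (\<chi> j. t * z $ j + (if j = i then 1 else 0)) = t * int_dot h z + h $ i"
proof -
  have "int_dot h (\<chi> j. t * z $ j + (if j = i then 1 else 0))
      = (\<Sum>j\<in>UNIV. t * (h $ j * z $ j) + (if j = i then h $ j else 0))"
    unfolding int_dot_def by (rule sum.cong) (auto simp: algebra_simps)
  also have "\<dots> = t * int_dot h z + h $ i"
    by (simp add: int_dot_def sum.distrib sum_distrib_left)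
  finally show ?thesis .
qed

text \<open>Induction on \<open>D\<close>: if the current \<open>z\<close> is orthogonal to the new
  vector \<open>d\<close>, pick \<open>i\<close> with \<open>d $ i \<noteq> 0\<close> and pass to
  \<open>t * z + e_i\<close>. Its product with \<open>d\<close> is \<open>d $ i\<close>, and a large
  \<open>t\<close> keeps the other products nonzero.\<close>

lemma exists_nonorthogonal:
  fixes D :: "(int ^ 'd::finite) set"
  assumes "finite D" "0 \<notin> D"
  shows "\<exists>z. \<forall>h\<in>D. int_dot h z \<noteq> 0"
  using assms
proof (induction D rule: finite_induct)
  case empty
  then show ?case by simp
next
  case (insert d D)
  then obtain z where z: "\<forall>h\<in>D. int_dot h z \<noteq> 0" by auto
  show ?case
  proof (cases "int_dot d z = 0")
    case False
    then show ?thesis using z by auto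
  next
    case True
    obtain i where i: "d $ i \<noteq> 0"
      using insert.prems by (metis insertI1 vec_eq_iff zero_index)
    \<comment> \<open>The summand 1 makes \<open>t\<close> strictly larger than every
      \<open>\<bar>h $ i\<bar>\<close>, so \<open>h $ i\<close> cannot cancel a nonzero multiple of
      \<open>t\<close>.\<close>
    define t where "t = 1 + (\<Sum>h\<in>D. \<bar>h $ i\<bar>)"
    have "t * int_dot h z + h $ i \<noteq> 0" if "h \<in> D" for h
    proof
      assume "t * int_dot h z + h $ i = 0"
      then have "\<bar>h $ i\<bar> = \<bar>t\<bar> * \<bar>int_dot h z\<bar>"
        by (metis abs_minus_cancel abs_mult add_eq_0_iff)
      moreover have "1 \<le> \<bar>int_dot h z\<bar>" using z that by fastforce
      ultimately have "\<bar>t\<bar> \<le> \<bar>h $ i\<bar>"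
        using mult_left_mono[of 1 "\<bar>int_dot h z\<bar>" "\<bar>t\<bar>"] by simp
      moreover have "\<bar>h $ i\<bar> < t"
        unfolding t_def using member_le_sum[OF that, of "\<lambda>h. \<bar>h $ i\<bar>"] insert.hyps by simp
      ultimately show False by simp
    qed
    then have "\<forall>h\<in>insert d D. int_dot h (\<chi> j. t * z $ j + (if j = i then 1 else 0)) \<noteq> 0"
      using True i by (auto simp: int_dot_shift)
    then show ?thesis by blast
  qed
qed

lemma exists_separating_lattice:
  fixes S :: "(int ^ 'd::finite) set"
  assumes "finite S"
  shows "\<exists>n\<ge>1. \<exists>z. \<forall>h\<in>S. \<forall>h'\<in>S. h \<noteq> h' \<longrightarrow> \<not> [int_dot h z = int_dot h' z] (mod int n)"
proof -
  define D where "D = (\<lambda>(h, h'). h - h') ` (S \<times> S) - {0}"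
  have finD: "finite D" unfolding D_def using assms by auto
  moreover have "0 \<notin> D" unfolding D_def by simp
  ultimately obtain z where z: "\<forall>h\<in>D. int_dot h z \<noteq> 0"
    using exists_nonorthogonal by blast
  \<comment> \<open>This \<open>n\<close> exceeds the absolute value of every product with a vector
    of \<open>D\<close>; these products are nonzero, so \<open>n\<close> divides none of
    them.\<close>
  define n where "n = nat (1 + (\<Sum>h\<in>D. \<bar>int_dot h z\<bar>))"
  have n: "int n = 1 + (\<Sum>h\<in>D. \<bar>int_dot h z\<bar>)"
    unfolding n_def by (simp add: sum_nonneg)
  have "\<not> [int_dot h z = int_dot h' z] (mod int n)" if "h \<in> S" "h' \<in> S" "h \<noteq> h'" for h h'
  proof
    assume "[int_dot h z = int_dot h' z] (mod int n)"
    then have dvd: "int n dvd int_dot (h - h') z"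
      by (simp add: cong_iff_dvd_diff int_dot_diff)
    have mem: "h - h' \<in> D" unfolding D_def using that by force
    then have "int n \<le> \<bar>int_dot (h - h') z\<bar>"
      using dvd_imp_le_int[OF bspec[OF z mem] dvd] by simp
    moreover have "\<bar>int_dot (h - h') z\<bar> < int n"
      unfolding n using member_le_sum[OF mem, of "\<lambda>h. \<bar>int_dot h z\<bar>"] finD by simp
    ultimately show False by simp
  qed
  moreover have "0 \<le> (\<Sum>h\<in>D. \<bar>int_dot h z\<bar>)" by (simp add: sum_nonneg)
  then have "n \<ge> 1" using n by linarith
  ultimately show ?thesis by blast
qed

section \<open>Sign changes and mirrored sets\<close>

lemma id_in_sign_changes: "(\<lambda>h. h) \<in> sign_changes k"
  unfolding sign_changes_def by (auto intro!: exI[of _ "\<lambda>_. 1"])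

lemma sign_changes_negate:
  assumes "\<sigma> \<in> sign_changes k"
  shows "\<exists>\<tau>\<in>sign_changes k. \<tau> k = - \<sigma> k"
proof -
  obtain s where s: "\<forall>i. s i = 1 \<or> s i = -1" "\<forall>i. k $ i = 0 \<longrightarrow> s i = 1"
    and \<sigma>: "\<sigma> = (\<lambda>h. \<chi> i. s i * h $ i)"
    using assms unfolding sign_changes_def by auto
  \<comment> \<open>Plain \<open>- s\<close> is not a legal pattern, since signs must be 1 where
    \<open>k\<close> vanishes; there the sign does not affect the image of \<open>k\<close>.\<close>
  define s' where "s' i = (if k $ i = 0 then 1 else - s i)" for i
  have "(\<lambda>h. \<chi> i. s' i * h $ i) \<in> sign_changes k"
    unfolding sign_changes_def
  proof (intro CollectI exI[of _ s'] conjI)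
    show "\<forall>i. s' i = 1 \<or> s' i = -1"
    proof
      fix i show "s' i = 1 \<or> s' i = -1"
        using s(1)[rule_format, of i] by (auto simp: s'_def)
    qed
  qed (simp_all add: s'_def)
  moreover have "(\<chi> i. s' i * k $ i) = - \<sigma> k"
    unfolding \<sigma> s'_def by (auto simp: vec_eq_iff)
  ultimately show ?thesis by (metis (mono_tags, lifting))
qed

lemma abs_sign_change:
  assumes "\<sigma> \<in> sign_changes k"
  shows "\<bar>\<sigma> k $ i\<bar> = \<bar>k $ i\<bar>"
proof -
  obtain s where s: "\<forall>i. s i = 1 \<or> s i = -1" and \<sigma>: "\<sigma> = (\<lambda>h. \<chi> i. s i * h $ i)"
    using assms unfolding sign_changes_def by auto
  show ?thesis using s[rule_format, of i] by (auto simp: \<sigma>)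
qed

lemma finite_sign_changes: "finite (sign_changes (k :: int ^ 'd::finite))"
proof (rule finite_subset)
  \<comment> \<open>The vacuous clause for \<open>i \<notin> UNIV\<close> gives the set of patterns
    the shape that \<open>finite_set_of_finite_funs\<close> expects.\<close>
  show "sign_changes k \<subseteq>
      (\<lambda>s h. \<chi> i. s i * h $ i) ` {s. \<forall>i. (i \<in> UNIV \<longrightarrow> s i \<in> {1, -1}) \<and> (i \<notin> UNIV \<longrightarrow> s i = 1)}"
    unfolding sign_changes_def by auto
  show "finite ((\<lambda>s (h :: int ^ 'd). \<chi> i. s i * h $ i) `
      {s :: 'd \<Rightarrow> int. \<forall>i. (i \<in> UNIV \<longrightarrow> s i \<in> {1, -1}) \<and> (i \<notin> UNIV \<longrightarrow> s i = 1)})"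
    by (intro finite_imageI finite_set_of_finite_funs) auto
qed

lemma finite_mirrored:
  fixes \<Lambda> :: "(int ^ 'd::finite) set"
  assumes "finite \<Lambda>"
  shows "finite (mirrored \<Lambda>)"
proof -
  have "mirrored \<Lambda> = (\<Union>k\<in>\<Lambda>. (\<lambda>\<sigma>. \<sigma> k) ` sign_changes k)"
    unfolding mirrored_def by blast
  then show ?thesis using assms by (simp add: finite_sign_changes)
qed

lemma mirroredI: "k \<in> \<Lambda> \<Longrightarrow> \<sigma> \<in> sign_changes k \<Longrightarrow> \<sigma> k \<in> mirrored \<Lambda>"
  unfolding mirrored_def by blast

lemma subset_mirrored: "\<Lambda> \<subseteq> mirrored \<Lambda>"
proof
  fix k assume "k \<in> \<Lambda>"
  from mirroredI[OF this id_in_sign_changes] show "k \<in> mirrored \<Lambda>" .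
qed

lemma uminus_mirrored: "h \<in> mirrored \<Lambda> \<Longrightarrow> - h \<in> mirrored \<Lambda>"
  unfolding mirrored_def using sign_changes_negate by (smt (verit) mem_Collect_eq)

lemma zero_notin_mirrored:
  assumes "0 \<notin> \<Lambda>"
  shows "0 \<notin> mirrored \<Lambda>"
proof
  assume "0 \<in> mirrored \<Lambda>"
  then obtain \<sigma> k where k: "k \<in> \<Lambda>" "\<sigma> \<in> sign_changes k" "\<sigma> k = 0"
    unfolding mirrored_def by force
  have "\<bar>k $ i\<bar> = 0" for i
    using abs_sign_change[OF k(2), of i] by (simp add: k(3))
  then have "k = 0" by (simp add: vec_eq_iff)
  then show False using k(1) assms by simp
qed

section \<open>Implications between the plans\<close>

lemma admissible_A_imp_B: "admissible_A \<Lambda> n z \<Longrightarrow> admissible_B \<Lambda> n z"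
  unfolding admissible_A_def admissible_B_def using mirroredI subset_mirrored by blast

text \<open>Sign changes preserve absolute values of coordinates, so a mirror image of
  \<open>h\<close> that is itself nonnegative must be \<open>h\<close>. Hence
  \<open>h \<noteq> h'\<close> in \<open>\<Lambda>\<close> implies
  \<open>\<sigma> h \<noteq> h'\<close>.\<close>

lemma admissible_B_imp_C:
  assumes "\<Lambda> \<subseteq> nonneg_vectors" and "admissible_B \<Lambda> n z"
  shows "admissible_C \<Lambda> n z"
proof -
  have "\<sigma> h \<noteq> h'" if "h \<in> \<Lambda>" "h' \<in> \<Lambda>" "\<sigma> \<in> sign_changes h" "h \<noteq> h'" for \<sigma> h h'
  proof
    assume "\<sigma> h = h'"
    then have "h' $ i = h $ i" for i
    proof -
      have "0 \<le> h $ i" "0 \<le> h' $ i"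
        using that(1,2) assms(1) by (auto simp: nonneg_vectors_def)
      then show ?thesis
        using abs_sign_change[OF that(3), of i] \<open>\<sigma> h = h'\<close> by simp
    qed
    then show False using that(4) by (simp add: vec_eq_iff)
  qed
  then show ?thesis using assms(2) unfolding admissible_B_def admissible_C_def by blast
qed

section \<open>Pigeonhole counting of residues for a set and its negatives\<close>

lemma card_le_modulus:
  assumes "n \<ge> 1" and "inj_on (\<lambda>h. int_dot h z mod int n) T"
  shows "card T \<le> n"
proof -
  have "card T = card ((\<lambda>h. int_dot h z mod int n) ` T)"
    using card_image[OF assms(2)] by simp
  also have "\<dots> \<le> card {0..<int n}"
    by (rule card_mono) (use assms(1) in auto)
  finally show ?thesis by simp
qed

lemma card_Un_negatives:
  assumes "finite L" "L \<subseteq> nonneg_vectors" "P \<subseteq> L" "0 \<notin> P"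
  shows "card (L \<union> uminus ` P) = card L + card P"
proof -
  have "- h \<notin> L" if "h \<in> P" for h
  proof
    assume "- h \<in> L"
    with that assms(2,3) have "\<forall>i. 0 \<le> h $ i \<and> 0 \<le> - h $ i"
      unfolding nonneg_vectors_def by fastforce
    then have "h = 0" by (simp add: vec_eq_iff order_antisym)
    with that assms(4) show False by simp
  qed
  then have "L \<inter> uminus ` P = {}" by blast
  moreover have "finite P" using assms(1,3) by (rule finite_subset[rotated])
  ultimately show ?thesis
    using assms(1) by (simp add: card_Un_disjoint card_image)
qed

text \<open>A collision between two negatives becomes, after negation, a collision inside
  \<open>L\<close>; the mixed collisions are those excluded by \<open>neg\<close>.\<close>

lemma inj_on_Un_negatives:
  assumes inj: "inj_on (\<lambda>h. int_dot h z mod int n) L" and "P \<subseteq> L"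
    and neg: "\<And>h h'. h \<in> P \<Longrightarrow> h' \<in> L \<Longrightarrow> \<not> [- int_dot h z = int_dot h' z] (mod int n)"
  shows "inj_on (\<lambda>h. int_dot h z mod int n) (L \<union> uminus ` P)"
proof -
  have "inj_on (\<lambda>h. int_dot h z mod int n) (uminus ` P)"
    using inj_on_subset[OF inj assms(2)]
    by (auto simp: inj_on_def cong_def[symmetric] cong_minus_minus_iff)
  moreover have "int_dot h z mod int n \<noteq> int_dot k z mod int n"
    if "h \<in> L" "k \<in> uminus ` P" for h k
    using that neg by (fastforce simp: cong_def)
  ultimately show ?thesis
    using inj by (intro inj_onI) (metis UnE inj_on_def)
qed

section \<open>Lower bounds on \<open>n\<close> for an admissible pair\<close>

lemma admissible_C_minus:
  assumes "admissible_C \<Lambda> n z" "h \<in> \<Lambda>" "h' \<in> \<Lambda>" "h \<noteq> h'"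
  shows "\<not> [- int_dot h z = int_dot h' z] (mod int n)"
  using assms sign_changes_negate[OF id_in_sign_changes, of h]
  unfolding admissible_C_def by (metis int_dot_minus)

lemma admissible_C_inj:
  assumes "admissible_C \<Lambda> n z"
  shows "inj_on (\<lambda>h. int_dot h z mod int n) \<Lambda>"
proof (intro inj_onI)
  fix h h' assume "h \<in> \<Lambda>" "h' \<in> \<Lambda>" "int_dot h z mod int n = int_dot h' z mod int n"
  then show "h = h'"
    using assms[unfolded admissible_C_def cong_def, rule_format, OF _ _ id_in_sign_changes]
    by blast
qed

text \<open>If \<open>0 \<notin> \<Lambda>\<close>, a mirrored \<open>h\<close> of residue 0 would
  share it with \<open>- h\<close>, which is also mirrored and differs from \<open>h\<close>. So
  adjoining the zero vector costs one further residue.\<close>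

lemma card_le_of_admissible_A:
  fixes \<Lambda> :: "(int ^ 'd::finite) set"
  assumes fin: "finite \<Lambda>" and n: "n \<ge> 1" and adm: "admissible_A \<Lambda> n z"
  shows "card (mirrored \<Lambda>) + (if 0 \<notin> \<Lambda> then 1 else 0) \<le> n"
proof -
  have inj: "inj_on (\<lambda>h. int_dot h z mod int n) (mirrored \<Lambda>)"
    using adm unfolding admissible_A_def inj_on_def cong_def by blast
  show ?thesis
  proof (cases "0 \<in> \<Lambda>")
    case True
    then show ?thesis using card_le_modulus[OF n inj] by simp
  next
    case False
    then have 0: "0 \<notin> mirrored \<Lambda>" by (rule zero_notin_mirrored)
    have "int_dot h z mod int n \<noteq> 0" if h: "h \<in> mirrored \<Lambda>" for h
    proof
      assume "int_dot h z mod int n = 0"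
      then have "[int_dot h z = int_dot (- h) z] (mod int n)"
        by (simp add: cong_iff_dvd_diff mod_eq_0_iff_dvd)
      then have "h = - h"
        using adm h uminus_mirrored unfolding admissible_A_def by blast
      then have "h = 0" by (simp add: vec_eq_iff)
      then show False using h 0 by simp
    qed
    then have "inj_on (\<lambda>h. int_dot h z mod int n) (insert 0 (mirrored \<Lambda>))"
      using inj by (auto simp: inj_on_insert)
    from card_le_modulus[OF n this] show ?thesis
      using False 0 finite_mirrored[OF fin] by simp
  qed
qed

text \<open>Plan B also constrains the case \<open>h' = h\<close> with
  \<open>\<sigma> h = - h\<close>, so no nonzero \<open>h\<close> is congruent to its own negative.
  Removing 0 and adjoining it again treats both cases for \<open>0 \<in> \<Lambda>\<close> at
  once.\<close>

lemma card_le_of_admissible_B: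
  fixes \<Lambda> :: "(int ^ 'd::finite) set"
  assumes fin: "finite \<Lambda>" and nonneg: "\<Lambda> \<subseteq> nonneg_vectors"
    and n: "n \<ge> 1" and adm: "admissible_B \<Lambda> n z"
  shows "2 * card (\<Lambda> - {0}) + 1 \<le> n"
proof -
  define P where "P = \<Lambda> - {0}"
  have P: "finite P" "P \<subseteq> nonneg_vectors" "0 \<notin> P" using fin nonneg by (auto simp: P_def)
  note admC = admissible_B_imp_C[OF nonneg adm]
  have self: "\<not> [- int_dot h z = int_dot h z] (mod int n)" if h: "h \<in> P" for h
  proof -
    obtain \<tau> where \<tau>: "\<tau> \<in> sign_changes h" "\<tau> h = - h"
      using sign_changes_negate[OF id_in_sign_changes] by blast
    have "- h \<noteq> h" proof
      assume "- h = h"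
      then have "h $ i = 0" for i
        using arg_cong[OF \<open>- h = h\<close>, of "\<lambda>v. v $ i"] by simp
      then have "h = 0" by (simp add: vec_eq_iff)
      with h P(3) show False by simp
    qed
    then show ?thesis
      using adm h \<tau> unfolding admissible_B_def P_def by (metis DiffD1 int_dot_minus)
  qed
  have "\<not> [- int_dot h z = int_dot h' z] (mod int n)" if "h \<in> P" "h' \<in> P" for h h'
    using that self admissible_C_minus[OF admC] unfolding P_def by (cases "h = h'") auto
  moreover have "inj_on (\<lambda>h. int_dot h z mod int n) P"
    using admissible_C_inj[OF admC] by (rule inj_on_subset) (auto simp: P_def)
  ultimately have inj: "inj_on (\<lambda>h. int_dot h z mod int n) (P \<union> uminus ` P)"
    by (intro inj_on_Un_negatives) auto
  have "\<not> int n dvd int_dot h z" if "h \<in> P" for h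
  proof
    assume "int n dvd int_dot h z"
    then have "[- int_dot h z = int_dot h z] (mod int n)"
      by (simp add: cong_iff_dvd_diff)
    then show False using self that by blast
  qed
  then have "\<forall>h \<in> P \<union> uminus ` P. int_dot h z mod int n \<noteq> 0"
    by (auto simp: mod_eq_0_iff_dvd)
  then have "inj_on (\<lambda>h. int_dot h z mod int n) (insert 0 (P \<union> uminus ` P))"
    using inj unfolding inj_on_insert int_dot_zero mod_0 by (metis (no_types, lifting) DiffD1 imageE)
  moreover have "0 \<notin> P \<union> uminus ` P" using P(3) by force
  then have "card (insert 0 (P \<union> uminus ` P)) = 2 * card P + 1"
    using card_Un_negatives[OF P(1,2) order_refl P(3)] P(1) by simp
  ultimately show ?thesis using card_le_modulus[OF n] unfolding P_def by metis
qed

lemma card_le_of_admissible_C: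
  fixes \<Lambda> :: "(int ^ 'd::finite) set"
  assumes fin: "finite \<Lambda>" and nonneg: "\<Lambda> \<subseteq> nonneg_vectors"
    and n: "n \<ge> 1" and adm: "admissible_C \<Lambda> n z"
  shows "2 * card \<Lambda> \<le> n + 2"
proof -
  \<comment> \<open>Plan C lets \<open>h\<close> collide with its own mirror images;
    \<open>E\<close> collects the vectors congruent to their negatives, including 0 if it lies in
    \<open>\<Lambda>\<close>.\<close>
  define E where "E = {h \<in> \<Lambda>. [- int_dot h z = int_dot h z] (mod int n)}"
  define P where "P = \<Lambda> - E"
  have P: "P \<subseteq> \<Lambda>" "0 \<notin> P" by (auto simp: P_def E_def)
  have "\<not> [- int_dot h z = int_dot h' z] (mod int n)" if "h \<in> P" "h' \<in> \<Lambda>" for h h'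
    using that admissible_C_minus[OF adm] unfolding P_def E_def by (cases "h = h'") auto
  with admissible_C_inj[OF adm] P(1)
  have "inj_on (\<lambda>h. int_dot h z mod int n) (\<Lambda> \<union> uminus ` P)"
    by (rule inj_on_Un_negatives)
  from card_le_modulus[OF n this] have cardP: "card \<Lambda> + card P \<le> n"
    using card_Un_negatives[OF fin nonneg P] by simp
  have "int_dot h z mod int n \<in> {0, int n div 2}" if "h \<in> E" for h
  proof -
    define r where "r = int_dot h z mod int n"
    have r: "0 \<le> r" "r < int n" using n by (auto simp: r_def)
    have "int n dvd 2 * int_dot h z"
      using that by (simp add: E_def cong_iff_dvd_diff)
    then have "int n dvd 2 * r"
      unfolding r_def by (metis dvd_eq_mod_eq_0 mod_mult_right_eq)
    then obtain q where q: "2 * r = int n * q" by (elim dvdE)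
    \<comment> \<open>From \<open>0 \<le> 2 * r < 2 * n\<close> the quotient \<open>q\<close> is 0
      or 1, which gives \<open>r = 0\<close> or \<open>r = n / 2\<close>.\<close>
    have "int n * 0 \<le> int n * q" using q r by linarith
    then have "0 \<le> q" by (rule mult_left_le_imp_le) (use n in simp)
    moreover have "q < 2"
    proof -
      have "int n * q < int n * 2" using q r by linarith
      then show ?thesis by (rule mult_left_less_imp_less) simp
    qed
    ultimately have "q = 0 \<or> q = 1" by auto
    then show ?thesis using q by (auto simp: r_def[symmetric])
  qed
  then have "(\<lambda>h. int_dot h z mod int n) ` E \<subseteq> {0, int n div 2}" by blast
  then have "card ((\<lambda>h. int_dot h z mod int n) ` E) \<le> card {0, int n div 2}"
    by (intro card_mono) auto
  moreover have "inj_on (\<lambda>h. int_dot h z mod int n) E"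
    using admissible_C_inj[OF adm] by (rule inj_on_subset) (auto simp: E_def)
  \<comment> \<open>Only an upper bound: the two values coincide when \<open>n = 1\<close>.\<close>
  moreover have "card {0, int n div 2} \<le> 2" by (simp add: card_insert_if)
  ultimately have "card E \<le> 2" by (simp add: card_image)
  moreover have "card \<Lambda> = card P + card E"
    using fin by (simp add: P_def E_def card_Diff_subset card_mono)
  ultimately show ?thesis using cardP by simp
qed

theorem mainTheorem1:
  fixes \<Lambda> :: "(int ^ 'd::finite) set"
  assumes "finite \<Lambda>" and "\<Lambda> \<subseteq> nonneg_vectors"
  shows "nstar_A \<Lambda> \<ge> card (mirrored \<Lambda>) + (if 0 \<notin> \<Lambda> then 1 else 0)
       \<and> int (nstar_B \<Lambda>) \<ge> 2 * int (card \<Lambda>) + (if 0 \<notin> \<Lambda> then 1 else -1)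
       \<and> int (nstar_C \<Lambda>) \<ge> 2 * int (card \<Lambda>) - 2"
proof -
  \<comment> \<open>\<open>LEAST\<close> has the defining property only if some \<open>n\<close>
    satisfies it. Existence is shown for Plan A and passes down to B and C.\<close>
  have exA: "\<exists>n. n \<ge> 1 \<and> (\<exists>z. admissible_A \<Lambda> n z)"
    using exists_separating_lattice[OF finite_mirrored[OF assms(1)]]
    unfolding admissible_A_def by blast
  then have exB: "\<exists>n. n \<ge> 1 \<and> (\<exists>z. admissible_B \<Lambda> n z)"
    using admissible_A_imp_B by blast
  then have exC: "\<exists>n. n \<ge> 1 \<and> (\<exists>z. admissible_C \<Lambda> n z)"
    using admissible_B_imp_C[OF assms(2)] by blast
  obtain zA zB zC where
    A: "nstar_A \<Lambda> \<ge> 1" "admissible_A \<Lambda> (nstar_A \<Lambda>) zA" and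
    B: "nstar_B \<Lambda> \<ge> 1" "admissible_B \<Lambda> (nstar_B \<Lambda>) zB" and
    C: "nstar_C \<Lambda> \<ge> 1" "admissible_C \<Lambda> (nstar_C \<Lambda>) zC"
    using LeastI_ex[OF exA] LeastI_ex[OF exB] LeastI_ex[OF exC]
    unfolding nstar_A_def nstar_B_def nstar_C_def by blast
  \<comment> \<open>If \<open>0 \<in> \<Lambda>\<close>, then \<open>card (\<Lambda> - {0})\<close>
    is \<open>card \<Lambda> - 1\<close>, and \<open>2 * (card \<Lambda> - 1) + 1\<close> accounts
    for the summand -1.\<close>
  have "int (nstar_B \<Lambda>) \<ge> 2 * int (card \<Lambda>) + (if 0 \<notin> \<Lambda> then 1 else -1)"
    using card_le_of_admissible_B[OF assms B] assms(1) card_Suc_Diff1[OF assms(1), of 0]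
    by (cases "0 \<in> \<Lambda>") auto
  then show ?thesis
    using card_le_of_admissible_A[OF assms(1) A] card_le_of_admissible_C[OF assms C] by auto
qed

end
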